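(* Let $\varepsilon > 0$ and, for each $n \in \mathbb{N}$, let $X_n$ be a random variable taking values in $\{0,\ldots,n\}$, with mean $\mu_n$, standard deviation $\sigma_n$ and probability generating function $P_n$. Suppose that for all sufficiently large $n$ we have $\sigma_n > n^{\varepsilon}$ and every complex root $\zeta$ of $P_n$ satisfies $|1-\zeta| > 1/\sigma_n^{1-\varepsilon}$. Then the sequence $\{X_n\}$ satisfies a central limit theorem.
   Context: The probability generating function of a random variable $X_n \in \{0,\ldots,n\}$ is the polynomial $P_n(z) = \sum_{k=0}^n \mathbb{P}(X_n = k) z^k$. A sequence $\{X_n\}$ with means $\mu_n$ and standard deviations $\sigma_n$ (positive for all large $n$) satisfies a central limit theorem if $X_n^* = (X_n - \mu_n)\sigma_n^{-1}$ converges in distribution to a standard normal random variable $Z \sim \mathcal{N}(0,1)$ as $n \to \infty$. *)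

theory Defs
  imports "HOL-Probability.Probability" "HOL-Computational_Algebra.Polynomial"
begin

definition mean :: "'a measure \<Rightarrow> ('a \<Rightarrow> nat) \<Rightarrow> real" where
  "mean M X = prob_space.expectation M (\<lambda>\<omega>. real (X \<omega>))"

definition std_dev :: "'a measure \<Rightarrow> ('a \<Rightarrow> nat) \<Rightarrow> real" where
  "std_dev M X = sqrt (prob_space.variance M (\<lambda>\<omega>. real (X \<omega>)))"

(* n is the upper bound on the values of X; the polynomial is taken over the complex
   numbers because the hypothesis concerns its complex roots. *)
definition pgf :: "'a measure \<Rightarrow> nat \<Rightarrow> ('a \<Rightarrow> nat) \<Rightarrow> complex poly" where
  "pgf M n X =
     (\<Sum>k=0..n. monom (complex_of_real (measure M {\<omega> \<in> space M. X \<omega> = k})) k)"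

definition standardized :: "'a measure \<Rightarrow> ('a \<Rightarrow> nat) \<Rightarrow> 'a \<Rightarrow> real" where
  "standardized M X \<omega> = (real (X \<omega>) - mean M X) / std_dev M X"

(* Each X n lives on its own probability space M n. For the finitely many n with
   std_dev = 0, division by zero makes the standardized variable 0, which does not
   affect the limit. *)
definition satisfies_clt :: "(nat \<Rightarrow> 'a measure) \<Rightarrow> (nat \<Rightarrow> 'a \<Rightarrow> nat) \<Rightarrow> bool" where
  "satisfies_clt M X \<longleftrightarrow>
     (\<forall>\<^sub>F n in sequentially. std_dev (M n) (X n) > 0) \<and>
     weak_conv_m (\<lambda>n. distr (M n) borel (standardized (M n) (X n))) std_normal_distribution"

end

theory Submission
  imports Defs "HOL-Complex_Analysis.Complex_Analysis"
    "HOL-Computational_Algebra.Fundamental_Theorem_Algebra" "HOL-Real_Asymp.Real_Asymp"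
begin

text \<open>
  One may assume \<open>\<epsilon> \<le> 1\<close>. Let \<open>g\<close> be the moment generating function of the standardized variable, that is,
  \<open>g(w) = exp (- \<mu> * w / \<sigma>) * P (exp (w / \<sigma>))\<close>. Since \<open>P\<close> has no root within \<open>\<delta> = 1 / \<sigma> powr (1 - \<epsilon>)\<close> of 1,
  \<open>g\<close> has no zero in a disc whose radius \<open>\<rho>\<close> is a constant multiple of \<open>\<sigma> * \<delta> = \<sigma> powr \<epsilon>\<close>, which tends to
  infinity at least like a fixed power of \<open>n\<close>. On this disc \<open>log g\<close> has a Taylor series
  \<open>w\<^sup>2 / 2 + (\<Sum>j\<ge>3. a j * w ^ j)\<close> with real coefficients, and the central limit theorem follows from
  Levy's continuity theorem once all the terms with \<open>j \<ge> 3\<close> are shown to vanish in the limit.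

  For large \<open>j\<close> a crude estimate is enough. The logarithmic derivative of \<open>P\<close> is a sum over at most \<open>n\<close>
  roots (\<open>logarithmic_derivative_bound\<close>), so Cauchy's inequality gives \<open>\<bar>a j\<bar> = O(n / \<rho> ^ (j - 1))\<close>
  (\<open>log_power_series\<close>, \<open>standardized_log_mgf\<close>). As \<open>\<rho>\<close> exceeds a power of \<open>n\<close>, this is negligible
  beyond a degree \<open>K\<close> that depends on \<open>\<epsilon>\<close> only.

  For the finitely many degrees from 3 to \<open>K\<close>, positivity enters: since \<open>P\<close> has nonnegative coefficients,
  \<open>\<bar>g(w)\<bar> \<le> g(Re w)\<close>, that is, \<open>Re (log g(w)) \<le> log g(Re w)\<close>. Apart from the quadratic one, no term
  respects this inequality in every direction (\<open>angular_defect_both_signs\<close>). Therefore, on every disc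
  of radius \<open>R\<close>, each of these terms is bounded by a constant times the quadratic one
  (\<open>coefficients_bounded_by_quadratic_one\<close>), which says \<open>\<bar>a j\<bar> = O(R powr (2 - j))\<close>. As the radius \<open>R\<close> is
  arbitrary, \<open>a j \<rightarrow> 0\<close> (\<open>log_mgf_limit\<close>).
\<close>

section \<open>Polynomials whose real part is dominated by the real axis\<close>

text \<open>
  If \<open>h(w) = \<Sum>j. a j * w ^ j\<close> has real coefficients, then at \<open>w = r * exp (\<i> * \<theta>)\<close> the term
  of degree \<open>j\<close> contributes \<open>a j * r ^ j * angular_defect j \<theta>\<close> to \<open>h (Re w) - Re (h w)\<close>.
\<close>

definition angular_defect :: "nat \<Rightarrow> real \<Rightarrow> real" where
  "angular_defect j \<theta> = cos \<theta> ^ j - cos (real j * \<theta>)"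

lemma abs_angular_defect_le: "\<bar>angular_defect j \<theta>\<bar> \<le> 2"
proof -
  have "\<bar>cos \<theta> ^ j\<bar> \<le> 1" by (simp add: power_abs power_le_one)
  moreover have "\<bar>cos (real j * \<theta>)\<bar> \<le> 1" by simp
  ultimately show ?thesis unfolding angular_defect_def by linarith
qed

lemma abs_cos_pi_quotient_less_1:
  assumes "0 < x" "x < 1"
  shows "\<bar>cos (x * pi)\<bar> < 1"
proof -
  have "sin (x * pi) > 0" using assms by (intro sin_gt_zero) auto
  hence "(sin (x * pi))\<^sup>2 > 0" by simp
  hence "(cos (x * pi))\<^sup>2 < 1" using sin_cos_squared_add[of "x * pi"] by linarith
  thus ?thesis by (simp add: abs_square_less_1)
qed

text \<open>
  In degrees 1 and 2 the defect is \<open>0\<close> and \<open>sin\<^sup>2 \<theta>\<close>, so it never becomes negative. From degree 3 on it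
  has both signs: at \<open>\<theta> = \<pi> / j\<close> the value of \<open>cos (j * \<theta>)\<close> is \<open>- 1\<close>, at \<open>\<theta> = 2 * \<pi> / j\<close> it
  is \<open>1\<close>, and \<open>\<bar>cos \<theta>\<bar> < 1\<close> at both angles. Hence a monomial of degree at least 3 violates
  \<open>Re (h w) \<le> h (Re w)\<close> in some direction, whatever the sign of its coefficient.
\<close>

lemma angular_defect_both_signs:
  assumes "j \<ge> 3"
  shows "\<exists>c>0. \<forall>a. \<exists>\<theta>. a * angular_defect j \<theta> \<le> - c * \<bar>a\<bar>"
proof -
  have j: "real j \<ge> 3" using assms by simp
  define p where "p = cos (1 / real j * pi) ^ j"
  define q where "q = cos (2 / real j * pi) ^ j"
  have "\<bar>cos (1 / real j * pi)\<bar> < 1" "\<bar>cos (2 / real j * pi)\<bar> < 1"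
    using j by (intro abs_cos_pi_quotient_less_1; simp)+
  hence "\<bar>p\<bar> < 1" "\<bar>q\<bar> < 1"
    unfolding p_def q_def power_abs using assms by (auto simp only: power_less_one_iff abs_ge_zero)
  have d1: "angular_defect j (1 / real j * pi) = p + 1" 
    using j by (simp add: angular_defect_def p_def)
  have d2: "angular_defect j (2 / real j * pi) = q - 1" 
    using j by (simp add: angular_defect_def q_def)
  define c where "c = min (1 + p) (1 - q)"
  have "c > 0" using \<open>\<bar>p\<bar> < 1\<close> \<open>\<bar>q\<bar> < 1\<close> by (auto simp: c_def)
  moreover have "\<exists>\<theta>. a * angular_defect j \<theta> \<le> - c * \<bar>a\<bar>" for a
  proof (cases "a \<ge> 0")
    case True
    have "a * c \<le> a * (1 - q)" using True by (intro mult_left_mono) (auto simp: c_def)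
    hence "a * angular_defect j (2 / real j * pi) \<le> - c * \<bar>a\<bar>"
      unfolding d2 using True by (simp add: algebra_simps)
    thus ?thesis by blast
  next
    case False
    have "(-a) * c \<le> (-a) * (1 + p)" using False by (intro mult_left_mono) (auto simp: c_def)
    hence "a * angular_defect j (1 / real j * pi) \<le> - c * \<bar>a\<bar>"
      unfolding d1 using False by (simp add: algebra_simps)
    thus ?thesis by blast
  qed
  ultimately show ?thesis by blast
qed

text \<open>
  The inequality \<open>Re (h w) \<le> h (Re w) + \<tau>\<close> on the closed unit disc, for the polynomial \<open>h\<close> with
  coefficients \<open>a\<close> up to degree \<open>K\<close>, written in polar coordinates. The terms of degree 0 and 1
  cancel and are left out.
\<close>

definition nearly_dominated :: "nat \<Rightarrow> real \<Rightarrow> (nat \<Rightarrow> real) \<Rightarrow> bool" where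
  "nearly_dominated K \<tau> a \<longleftrightarrow>
     (\<forall>r \<theta>. 0 \<le> r \<longrightarrow> r \<le> 1 \<longrightarrow> (\<Sum>i=2..K. a i * r ^ i * angular_defect i \<theta>) \<ge> - \<tau>)"

text \<open>
  Evaluate the inequality at a small radius \<open>r\<close> and at the angle where the term of degree \<open>j\<close> is
  most negative. The terms of higher degree carry an additional factor \<open>r\<close>, which turns them
  into a small multiple of the sum of all \<open>\<bar>a i\<bar>\<close>; those of degree between 3 and \<open>j\<close> are
  controlled by induction. The small parameter \<open>\<delta>\<close> is quantified before the constant \<open>C\<close>, so
  that in the induction it can beat the constant \<open>1 / r ^ j\<close> of the current degree.
\<close>

lemma coefficient_bound_step:
  assumes "3 \<le> j" "j \<le> K" "\<delta> > 0"
  shows "\<exists>C\<ge>0. \<forall>a \<tau>. \<tau> \<ge> 0 \<longrightarrow> nearly_dominated K \<tau> a \<longrightarrow>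
           \<bar>a j\<bar> \<le> C * (\<bar>a 2\<bar> + \<tau>) + \<delta> * (\<Sum>i=3..K. \<bar>a i\<bar>)"
  using assms
proof (induction j arbitrary: \<delta> rule: less_induct)
  case (less j)
  obtain c where c: "c > 0" "\<And>a. \<exists>\<theta>. a * angular_defect j \<theta> \<le> - c * \<bar>a\<bar>"
    using angular_defect_both_signs[OF less.prems(1)] by blast
  \<comment> \<open>at this radius the higher degrees cost at most half of the allowed \<open>\<delta>\<close>\<close>
  define r where "r = min 1 (\<delta> * c / 4)"
  have r: "0 < r" "r \<le> 1" "2 * r / c \<le> \<delta> / 2"
    using c less.prems by (auto simp: r_def field_simps min_def)
  \<comment> \<open>the lower degrees, fewer than \<open>j\<close> of them and amplified by \<open>2 / (c * r ^ j)\<close>, cost the other half\<close>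
  define \<delta>' where "\<delta>' = \<delta> * c * r ^ j / (4 * real j)"
  have \<delta>': "\<delta>' > 0" using c r less.prems by (auto simp: \<delta>'_def)
  have "\<exists>C\<ge>0. \<forall>a \<tau>. \<tau> \<ge> 0 \<longrightarrow> nearly_dominated K \<tau> a \<longrightarrow>
           \<bar>a i\<bar> \<le> C * (\<bar>a 2\<bar> + \<tau>) + \<delta>' * (\<Sum>i=3..K. \<bar>a i\<bar>)" if "i \<in> {3..<j}" for i
    using less.IH[of i \<delta>'] that less.prems \<delta>' by auto
  then obtain C where C: "\<And>i. i \<in> {3..<j} \<Longrightarrow> C i \<ge> 0"
     "\<And>i a \<tau>. i \<in> {3..<j} \<Longrightarrow> \<tau> \<ge> 0 \<Longrightarrow> nearly_dominated K \<tau> a \<Longrightarrow>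
           \<bar>a i\<bar> \<le> C i * (\<bar>a 2\<bar> + \<tau>) + \<delta>' * (\<Sum>i=3..K. \<bar>a i\<bar>)"
    by metis
  define D where "D = (2 + 2 * (\<Sum>i=3..<j. C i)) / (c * r ^ j)"
  have "(\<Sum>i=3..<j. C i) \<ge> 0" using C(1) by (intro sum_nonneg) auto
  hence "D \<ge> 0" unfolding D_def using c r by simp
  moreover have "\<bar>a j\<bar> \<le> D * (\<bar>a 2\<bar> + \<tau>) + \<delta> * (\<Sum>i=3..K. \<bar>a i\<bar>)"
    if "\<tau> \<ge> 0" and dom: "nearly_dominated K \<tau> a" for a \<tau>
  proof -
    define A where "A = (\<Sum>i=3..K. \<bar>a i\<bar>)"
    define E where "E = \<bar>a 2\<bar> + \<tau>"
    have "A \<ge> 0" by (auto simp: A_def intro: sum_nonneg)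
    obtain \<theta> where \<theta>: "a j * angular_defect j \<theta> \<le> - c * \<bar>a j\<bar>" using c by blast
    have term_le: "a i * r ^ i * angular_defect i \<theta> \<le> 2 * \<bar>a i\<bar> * s" if "r ^ i \<le> s" for i s
    proof -
      have "a i * r ^ i * angular_defect i \<theta> \<le> \<bar>a i\<bar> * r ^ i * \<bar>angular_defect i \<theta>\<bar>"
        using r by (metis abs_ge_self abs_mult abs_of_pos zero_less_power)
      also have "\<dots> \<le> \<bar>a i\<bar> * s * 2" using r that abs_angular_defect_le
        by (intro mult_mono) (auto intro!: mult_nonneg_nonneg order_trans[OF zero_le_power that])
      finally show ?thesis by simp
    qed
    have split: "{2..K} = insert 2 (insert j ({3..<j} \<union> {j<..K}))"
      using less.prems by auto
    have "- \<tau> \<le> (\<Sum>i=2..K. a i * r ^ i * angular_defect i \<theta>)"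
      using dom r unfolding nearly_dominated_def by simp
    also have "\<dots> = a 2 * r ^ 2 * angular_defect 2 \<theta> + a j * r ^ j * angular_defect j \<theta> +
        (\<Sum>i=3..<j. a i * r ^ i * angular_defect i \<theta>) + (\<Sum>i\<in>{j<..K}. a i * r ^ i * angular_defect i \<theta>)"
      unfolding split using less.prems by (subst sum.insert, simp, force, subst sum.insert, simp, force, subst sum.union_disjoint) auto
    also have "\<dots> \<le> 2 * \<bar>a 2\<bar> * 1 + r ^ j * (- c * \<bar>a j\<bar>) +
        (\<Sum>i=3..<j. 2 * \<bar>a i\<bar> * 1) + (\<Sum>i\<in>{j<..K}. 2 * \<bar>a i\<bar> * (r * r ^ j))"
    proof (intro add_mono sum_mono term_le)
      show "a j * r ^ j * angular_defect j \<theta> \<le> r ^ j * (- c * \<bar>a j\<bar>)"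
        using mult_left_mono[OF \<theta>, of "r ^ j"] r by (simp add: algebra_simps)
      show "r ^ i \<le> r * r ^ j" if "i \<in> {j<..K}" for i
        using power_decreasing[of "Suc j" i r] that r by auto
    qed (use r in \<open>auto intro: power_le_one\<close>)
    also have "(\<Sum>i\<in>{j<..K}. 2 * \<bar>a i\<bar> * (r * r ^ j)) = 2 * r * r ^ j * (\<Sum>i\<in>{j<..K}. \<bar>a i\<bar>)"
      by (simp add: sum_distrib_left algebra_simps)
    also have "\<dots> \<le> 2 * r * r ^ j * A" unfolding A_def using less.prems r
      by (intro mult_left_mono sum_mono2) auto
    also have "(\<Sum>i=3..<j. 2 * \<bar>a i\<bar> * 1) = 2 * (\<Sum>i=3..<j. \<bar>a i\<bar>)"
      by (simp add: sum_distrib_left)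
    also have "(\<Sum>i=3..<j. \<bar>a i\<bar>) \<le> (\<Sum>i=3..<j. C i * E + \<delta>' * A)"
      unfolding A_def E_def using C(2)[OF _ that] by (intro sum_mono) auto
    also have "\<dots> = (\<Sum>i=3..<j. C i) * E + real (j - 3) * \<delta>' * A"
      by (simp add: sum.distrib sum_distrib_right)
    also have "real (j - 3) * \<delta>' * A \<le> real j * \<delta>' * A"
      using \<delta>' \<open>A \<ge> 0\<close> by (intro mult_right_mono) auto
    also have "real j * \<delta>' * A = \<delta> / 4 * (c * r ^ j) * A"
      using less.prems by (simp add: \<delta>'_def)
    finally have "(c * r ^ j) * \<bar>a j\<bar> \<le> (2 + 2 * (\<Sum>i=3..<j. C i)) * E + \<delta> / 2 * (c * r ^ j) * A + 2 * r * r ^ j * A"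
      using that(1) by (simp add: E_def algebra_simps)
    also have "(2 + 2 * (\<Sum>i=3..<j. C i)) = (c * r ^ j) * D"
      using c r by (simp add: D_def)
    also have "2 * r * r ^ j * A = (c * r ^ j) * (2 * r / c * A)" using c by simp
    also have "\<dots> \<le> (c * r ^ j) * (\<delta> / 2 * A)"
      using r c \<open>A \<ge> 0\<close> by (intro mult_left_mono mult_right_mono) auto
    finally have "(c * r ^ j) * \<bar>a j\<bar> \<le> (c * r ^ j) * (D * E + \<delta> * A)"
      by (simp add: algebra_simps)
    thus ?thesis using c r unfolding A_def E_def by (simp add: mult_le_cancel_left_pos)
  qed
  ultimately show ?case by blast
qed

text \<open>
  A quantitative form of the theorem of Marcinkiewicz that the exponential of a polynomial of
  degree greater than 2 is not a characteristic function. Summing the bounds of the previous lemma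
  over \<open>j\<close> lets the sum of all \<open>\<bar>a i\<bar>\<close> be absorbed into the left-hand side. It matters that \<open>C\<close>
  depends on \<open>K\<close> only.
\<close>

lemma coefficients_bounded_by_quadratic_one:
  "\<exists>C\<ge>0. \<forall>a \<tau> j. \<tau> \<ge> 0 \<longrightarrow> nearly_dominated K \<tau> a \<longrightarrow> 3 \<le> j \<longrightarrow> j \<le> K \<longrightarrow>
     \<bar>a j\<bar> \<le> C * (\<bar>a 2\<bar> + \<tau>)"
proof -
  define \<delta> where "\<delta> = 1 / (2 * real (K + 1))"
  have \<delta>: "\<delta> > 0" by (simp add: \<delta>_def)
  have "\<forall>j. \<exists>C. 3 \<le> j \<and> j \<le> K \<longrightarrow> C \<ge> 0 \<and> (\<forall>a \<tau>. \<tau> \<ge> 0 \<longrightarrow> nearly_dominated K \<tau> a \<longrightarrow>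
           \<bar>a j\<bar> \<le> C * (\<bar>a 2\<bar> + \<tau>) + \<delta> * (\<Sum>i=3..K. \<bar>a i\<bar>))"
    using coefficient_bound_step[OF _ _ \<delta>] by blast
  then obtain C where C: "\<And>j. 3 \<le> j \<Longrightarrow> j \<le> K \<Longrightarrow> C j \<ge> 0"
     "\<And>j a \<tau>. 3 \<le> j \<Longrightarrow> j \<le> K \<Longrightarrow> \<tau> \<ge> 0 \<Longrightarrow> nearly_dominated K \<tau> a \<Longrightarrow>
           \<bar>a j\<bar> \<le> C j * (\<bar>a 2\<bar> + \<tau>) + \<delta> * (\<Sum>i=3..K. \<bar>a i\<bar>)"
    by metis
  have "\<bar>a j\<bar> \<le> (2 * (\<Sum>i=3..K. C i)) * (\<bar>a 2\<bar> + \<tau>)"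
    if "\<tau> \<ge> 0" "nearly_dominated K \<tau> a" "3 \<le> j" "j \<le> K" for a \<tau> j
  proof -
    define A where "A = (\<Sum>i=3..K. \<bar>a i\<bar>)"
    have "A \<ge> 0" by (auto simp: A_def intro: sum_nonneg)
    have "A \<le> (\<Sum>i=3..K. C i * (\<bar>a 2\<bar> + \<tau>) + \<delta> * A)"
      unfolding A_def using C(2)[OF _ _ that(1,2)] by (intro sum_mono) auto
    also have "\<dots> = (\<Sum>i=3..K. C i) * (\<bar>a 2\<bar> + \<tau>) + (real (K - 2) * \<delta>) * A"
      by (simp add: sum.distrib sum_distrib_right)
    also have "(real (K - 2) * \<delta>) * A \<le> 1 / 2 * A"
      using \<open>A \<ge> 0\<close> by (intro mult_right_mono) (auto simp: \<delta>_def field_simps)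
    finally have "A \<le> (2 * (\<Sum>i=3..K. C i)) * (\<bar>a 2\<bar> + \<tau>)" by (simp add: algebra_simps)
    moreover have "\<bar>a j\<bar> \<le> A" unfolding A_def using that by (intro member_le_sum) auto
    ultimately show ?thesis by simp
  qed
  moreover have "2 * (\<Sum>i=3..K. C i) \<ge> 0" using C(1) by (auto intro!: sum_nonneg)
  ultimately show ?thesis by blast
qed

section \<open>Logarithms of zero-free functions\<close>

text \<open>
  The logarithmic derivative \<open>p' / p\<close> is the sum of \<open>1 / (z - \<zeta>)\<close> over the roots \<open>\<zeta>\<close>, counted with
  multiplicity, and each of these terms is bounded by \<open>c\<close>. Splitting off one root at a time gives
  the estimate without division.
\<close>

lemma logarithmic_derivative_bound:
  fixes p :: "complex poly"
  assumes "\<And>\<zeta>. poly p \<zeta> = 0 \<Longrightarrow> 1 \<le> c * cmod (z - \<zeta>)"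
  shows "cmod (poly (pderiv p) z) \<le> real (degree p) * c * cmod (poly p z)"
  using assms
proof (induction "degree p" arbitrary: p)
  case 0
  then obtain b where "p = [:b:]" by (metis degree_eq_zeroE)
  thus ?case by simp
next
  case (Suc n)
  have "\<not> constant (poly p)" using Suc.hyps(2) by (simp add: constant_degree)
  then obtain \<zeta> where \<zeta>: "poly p \<zeta> = 0" using Fundamental_Theorem_Algebra.fundamental_theorem_of_algebra by blast
  then obtain q where q: "p = [:-\<zeta>, 1:] * q" by (auto simp: poly_eq_0_iff_dvd)
  have "q \<noteq> 0" using q Suc.hyps(2) by auto
  hence "degree p = Suc (degree q)" unfolding q by (subst degree_mult_eq) auto
  hence n: "n = degree q" using Suc.hyps(2) by simp
  have IH: "cmod (poly (pderiv q) z) \<le> real n * c * cmod (poly q z)"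
    unfolding n by (rule Suc.hyps(1)[OF n]) (use Suc.prems q in auto)
  have "cmod (poly (pderiv p) z) = cmod (poly q z + (z - \<zeta>) * poly (pderiv q) z)"
    unfolding q pderiv_mult by (simp add: pderiv_pCons algebra_simps)
  also have "\<dots> \<le> cmod (poly q z) * 1 + cmod (z - \<zeta>) * cmod (poly (pderiv q) z)"
    by (metis norm_mult norm_triangle_ineq mult_1_right)
  also have "\<dots> \<le> cmod (poly q z) * (c * cmod (z - \<zeta>)) + cmod (z - \<zeta>) * (real n * c * cmod (poly q z))"
    using IH Suc.prems[OF \<zeta>] by (intro add_mono mult_left_mono) auto
  also have "\<dots> = (real n + 1) * c * (cmod (z - \<zeta>) * cmod (poly q z))" by (simp add: algebra_simps)
  also have "cmod (z - \<zeta>) * cmod (poly q z) = cmod (poly p z)"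
    unfolding q by (simp flip: norm_mult add: algebra_simps)
  finally show ?case unfolding Suc.hyps(2)[symmetric] by (simp add: add.commute)
qed

text \<open>
  The Taylor series of the cumulant generating function \<open>h\<close> of a random variable with mean 0
  and variance 1, so that \<open>a j\<close> is the \<open>j\<close>-th cumulant divided by \<open>fact j\<close>. The bounds on the
  coefficients are the Cauchy estimates that follow from \<open>\<bar>h\<bar> \<le> B * \<rho>\<close> on the circle of radius \<open>\<rho>\<close>.
\<close>

definition standardized_log_series ::
    "real \<Rightarrow> real \<Rightarrow> (nat \<Rightarrow> real) \<Rightarrow> (complex \<Rightarrow> complex) \<Rightarrow> bool" where
  "standardized_log_series B \<rho> a h \<longleftrightarrow>
     0 \<le> B \<and> a 0 = 0 \<and> a 1 = 0 \<and> a 2 = 1 / 2 \<and> (\<forall>j. \<bar>a j\<bar> \<le> B * \<rho> / \<rho> ^ j) \<and>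
     (\<forall>w. cmod w < \<rho> \<longrightarrow> (\<lambda>j. of_real (a j) * w ^ j) sums h w)"

text \<open>
  On a disc without zeros, \<open>g\<close> has a logarithm \<open>h\<close>, namely a primitive of \<open>g' / g\<close>. A bound on
  \<open>g' / g\<close> bounds \<open>h\<close> by integration along radii, and Cauchy's inequality then bounds its Taylor
  coefficients. The hypotheses are placed on the disc of twice the radius so that the circle of
  radius \<open>\<rho>\<close>, on which Cauchy's inequality is applied, lies inside the domain.
\<close>

lemma log_power_series:
  fixes g g' :: "complex \<Rightarrow> complex"
  assumes g: "\<And>w. (g has_field_derivative g' w) (at w)"
    and g'': "(g' has_field_derivative 1) (at 0)"
    and at_0: "g 0 = 1" "g' 0 = 0"
    and cnj: "\<And>w. g (cnj w) = cnj (g w)" "\<And>w. g' (cnj w) = cnj (g' w)"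
    and "\<rho> > 0"
    and nz: "\<And>w. cmod w < 2 * \<rho> \<Longrightarrow> g w \<noteq> 0"
    and bound: "\<And>w. cmod w < 2 * \<rho> \<Longrightarrow> cmod (g' w) \<le> B * cmod (g w)"
  shows "\<exists>a h. standardized_log_series B \<rho> a h \<and> (\<forall>w. cmod w < \<rho> \<longrightarrow> exp (h w) = g w)"
proof -
  define S where "S = ball (0::complex) (2 * \<rho>)"
  have S: "open S" "convex S" "0 \<in> S" "\<And>w. w \<in> S \<longleftrightarrow> cmod w < 2 * \<rho>"
    using \<open>\<rho> > 0\<close> by (auto simp: S_def)
  have holg: "g holomorphic_on UNIV"
    using g by (auto simp: holomorphic_on_def field_differentiable_def)
  have "deriv g = g'" using g by (auto intro: DERIV_imp_deriv)
  hence holg': "g' holomorphic_on UNIV" using holomorphic_deriv[OF holg] by simp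
  have "(\<lambda>w. g' w / g w) holomorphic_on S"
    using nz S by (intro holomorphic_intros holomorphic_on_subset[OF holg] holomorphic_on_subset[OF holg']) auto
  from holomorphic_convex_primitive'[OF S(2,1) this]
  obtain h1 where h1: "\<And>w. w \<in> S \<Longrightarrow> (h1 has_field_derivative g' w / g w) (at w within S)"
    by blast
  define h where "h w = h1 w - h1 0" for w
  have h: "(h has_field_derivative g' w / g w) (at w)" if "w \<in> S" for w
    using h1[OF that] at_within_open[OF that S(1)] unfolding h_def
    by (auto intro!: derivative_eq_intros)
  have h0: "h 0 = 0" by (simp add: h_def)
  have h_unique: "k w = c" if "\<And>w. w \<in> S \<Longrightarrow> (k has_field_derivative 0) (at w)" "k 0 = c" "w \<in> S" 
    for k :: "complex \<Rightarrow> complex" and c w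
  proof -
    have "\<exists>c. \<forall>x\<in>S. k x = c"
      using that(1) by (intro has_field_derivative_zero_constant[OF S(2)]) (auto intro: has_field_derivative_at_within)
    thus ?thesis using that S by metis
  qed
  have exp_h: "exp (h w) = g w" if "w \<in> S" for w
  proof -
    have "g w * exp (- h w) = 1"
    proof (rule h_unique[OF _ _ that])
      show "((\<lambda>w. g w * exp (- h w)) has_field_derivative 0) (at w)" if "w \<in> S" for w
        using nz that S by (auto intro!: derivative_eq_intros g h)
    qed (simp add: h0 at_0)
    thus ?thesis by (simp add: exp_minus field_simps)
  qed
  \<comment> \<open>\<open>w \<mapsto> cnj (h (cnj w))\<close> is a primitive of the same function with the same value at 0\<close>
  have h_cnj: "cnj (h (cnj w)) = h w" if "w \<in> S" for w
  proof -
    have "cnj (h (cnj w)) - h w = 0"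
    proof (rule h_unique[OF _ _ that])
      show "((\<lambda>w. cnj (h (cnj w)) - h w) has_field_derivative 0) (at w)" if "w \<in> S" for w
      proof -
        have "(h has_field_derivative g' (cnj w) / g (cnj w)) (at (cnj w))"
          using that S by (intro h) auto
        from has_field_derivative_cnj_cnj[OF this]
        have "((\<lambda>w. cnj (h (cnj w))) has_field_derivative g' w / g w) (at w)"
          by (simp add: cnj o_def)
        from DERIV_diff[OF this h[OF that]] show ?thesis by simp
      qed
    qed (simp add: h0)
    thus ?thesis by simp
  qed
  define c where "c j = (deriv ^^ j) h 0 / fact j" for j
  have hol_h: "h holomorphic_on S"
    using h by (auto simp: holomorphic_on_def field_differentiable_def intro: has_field_derivative_at_within)
  have c_sums: "(\<lambda>j. c j * w ^ j) sums h w" if "w \<in> S" for w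
    using holomorphic_power_series[of h 0 "2 * \<rho>" w] hol_h that unfolding S_def c_def by simp
  \<comment> \<open>by this symmetry the Taylor coefficients may be replaced by their real parts\<close>
  have Re_sums: "(\<lambda>j. of_real (Re (c j)) * w ^ j) sums h w" if "w \<in> S" for w
  proof -
    have "(\<lambda>j. cnj (c j * cnj w ^ j)) sums cnj (h (cnj w))"
      using c_sums[of "cnj w"] that S by (simp only: sums_cnj) simp
    hence "(\<lambda>j. cnj (c j) * w ^ j) sums h w" using h_cnj[OF that] by simp
    from sums_divide[OF sums_add[OF c_sums[OF that] this], of 2]
    have "(\<lambda>j. ((c j + cnj (c j)) / 2) * w ^ j) sums h w" by (simp add: algebra_simps add_divide_distrib)
    thus ?thesis by (simp add: complex_add_cnj)
  qed
  have sub: "cball 0 \<rho> \<subseteq> S" using \<open>\<rho> > 0\<close> by (simp add: S_def cball_subset_ball_iff)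
  have h_le: "cmod (h w) \<le> B * \<rho>" if "cmod w = \<rho>" for w
  proof -
    have "cmod (h w - h 0) \<le> B * cmod (w - 0)"
    proof (rule field_differentiable_bound[OF S(2)])
      show "(h has_field_derivative g' z / g z) (at z within S)" if "z \<in> S" for z
        using h[OF that] by (rule has_field_derivative_at_within)
      show "cmod (g' z / g z) \<le> B" if "z \<in> S" for z
        using bound[of z] nz[of z] that S by (simp add: norm_divide field_simps)
    qed (use sub that S in auto)
    thus ?thesis using that h0 by simp
  qed
  have c_le: "cmod (c j) \<le> B * \<rho> / \<rho> ^ j" for j
  proof -
    have "cmod ((deriv ^^ j) h 0) \<le> fact j * (B * \<rho>) / \<rho> ^ j"
    proof (rule Cauchy_inequality[OF _ _ \<open>\<rho> > 0\<close>])
      show "h holomorphic_on ball 0 \<rho>"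
        using hol_h sub ball_subset_cball by (meson holomorphic_on_subset order_trans)
      show "continuous_on (cball 0 \<rho>) h"
        using hol_h sub by (meson holomorphic_on_imp_continuous_on continuous_on_subset)
    qed (use h_le in auto)
    thus ?thesis unfolding c_def by (simp add: norm_divide field_simps)
  qed
  have deriv_h: "deriv h w = g' w / g w" if "w \<in> S" for w using h[OF that] by (rule DERIV_imp_deriv)
  have "((\<lambda>w. g' w / g w) has_field_derivative 1) (at 0)"
    using at_0 by (auto intro!: derivative_eq_intros g g'')
  hence "(deriv h has_field_derivative 1) (at 0)"
    by (rule has_field_derivative_transform_within_open[OF _ S(1,3)]) (simp add: deriv_h)
  hence "deriv (deriv h) 0 = 1" by (rule DERIV_imp_deriv)
  hence c2: "c 2 = 1 / 2" by (simp add: c_def numeral_2_eq_2)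
  have "0 \<le> B" using bound[of 0] \<open>\<rho> > 0\<close> by (simp add: at_0)
  moreover have "Re (c 0) = 0" by (simp add: c_def h0)
  moreover have "Re (c 1) = 0" using deriv_h[OF S(3)] by (simp add: c_def at_0)
  moreover have "Re (c 2) = 1 / 2" by (simp add: c2)
  moreover have "\<bar>Re (c j)\<bar> \<le> B * \<rho> / \<rho> ^ j" for j using abs_Re_le_cmod c_le order_trans by blast
  moreover have "w \<in> S" if "cmod w < \<rho>" for w using that \<open>\<rho> > 0\<close> by (simp add: S_def)
  ultimately have "standardized_log_series B \<rho> (\<lambda>j. Re (c j)) h"
    "\<forall>w. cmod w < \<rho> \<longrightarrow> exp (h w) = g w"
    using Re_sums exp_h unfolding standardized_log_series_def by auto
  thus ?thesis by blast
qed

section \<open>Convergence of cumulant generating functions\<close>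

lemma power_series_tail_le:
  fixes v :: "nat \<Rightarrow> 'b::banach"
  assumes a: "\<And>j. \<bar>a j\<bar> \<le> B * \<rho> / \<rho> ^ j" and "0 \<le> B" "0 < \<rho>" "0 \<le> R" "2 * R \<le> \<rho>"
    and v: "\<And>j. norm (v j) \<le> 2 * R ^ j"
    and S: "(\<lambda>j. a j *\<^sub>R v j) sums S"
  shows "norm (S - (\<Sum>j\<le>K. a j *\<^sub>R v j)) \<le> 4 * R ^ (K + 1) * (B / \<rho> ^ K)"
proof -
  define q where "q = R / \<rho>"
  have q: "0 \<le> q" "q \<le> 1 / 2" using assms by (auto simp: q_def field_simps)
  define f where "f i = a (i + Suc K) *\<^sub>R v (i + Suc K)" for i
  have "f sums (S - (\<Sum>j<Suc K. a j *\<^sub>R v j))"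
    unfolding f_def by (rule sums_split_initial_segment[OF S])
  hence f: "suminf f = S - (\<Sum>j\<le>K. a j *\<^sub>R v j)" by (simp add: sums_iff lessThan_Suc_atMost)
  define b where "b = 2 * B * \<rho> * q ^ Suc K"
  have "b \<ge> 0" using assms q by (simp add: b_def)
  have f_le: "norm (f i) \<le> b * q ^ i" for i
  proof -
    have "norm (f i) \<le> (B * \<rho> / \<rho> ^ (i + Suc K)) * (2 * R ^ (i + Suc K))"
      unfolding f_def norm_scaleR using assms by (intro mult_mono a v) auto
    also have "\<dots> = b * q ^ i" by (simp add: b_def q_def power_divide power_add field_simps)
    finally show ?thesis .
  qed
  have geo: "(\<lambda>i. b * q ^ i) sums (b * (1 / (1 - q)))"
    using q by (intro sums_mult geometric_sums) auto
  have "norm (suminf f) \<le> (\<Sum>i. b * q ^ i)"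
    by (rule norm_suminf_le[OF f_le sums_summable[OF geo]])
  also have "\<dots> = b * (1 / (1 - q))" using geo by (simp add: sums_iff)
  also have "\<dots> \<le> b * 2" using q \<open>b \<ge> 0\<close> by (intro mult_left_mono) (auto simp: field_simps)
  also have "\<dots> = 4 * R ^ (K + 1) * (B / \<rho> ^ K)"
    using assms by (simp add: b_def q_def power_divide)
  finally show ?thesis unfolding f .
qed

text \<open>
  Comparing \<open>h\<close> at \<open>w\<close> and at \<open>Re w\<close> gives a nonnegative series of angular defects. Cutting it off
  after degree \<open>K\<close> costs a geometric tail, and the factor \<open>R ^ j\<close> rescales the disc of radius \<open>R\<close> to
  the unit disc.
\<close>

lemma dominated_by_real_axis_imp_nearly_dominated:
  assumes series: "standardized_log_series B \<rho> a h" and "0 < R" "2 * R \<le> \<rho>"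
    and dom: "\<And>w. cmod w < \<rho> \<Longrightarrow> Re (h w) \<le> Re (h (of_real (Re w)))"
  shows "nearly_dominated K (4 * R ^ (K + 1) * (B / \<rho> ^ K)) (\<lambda>j. a j * R ^ j)"
  unfolding nearly_dominated_def
proof (intro allI impI)
  have a: "\<And>j. \<bar>a j\<bar> \<le> B * \<rho> / \<rho> ^ j" "a 0 = 0" "a 1 = 0" "0 \<le> B"
    and h: "\<And>w. cmod w < \<rho> \<Longrightarrow> (\<lambda>j. of_real (a j) * w ^ j) sums h w"
    using series by (auto simp: standardized_log_series_def)
  fix r \<theta> :: real assume r: "0 \<le> r" "r \<le> 1"
  define s where "s = r * R"
  have "s \<le> 1 * R" unfolding s_def using r assms by (intro mult_right_mono) auto
  hence s: "s \<le> R" by simp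
  moreover have "R < \<rho>" using assms by linarith
  moreover have "0 \<le> s" using r assms by (simp add: s_def)
  ultimately have s: "0 \<le> s" "s \<le> R" "s < \<rho>" by auto
  define w where "w = rcis s \<theta>"
  have w: "cmod w < \<rho>" "Re w = s * cos \<theta>" using s by (auto simp: w_def)
  have w': "cmod (of_real (Re w)) < \<rho>" 
    unfolding norm_of_real using abs_Re_le_cmod[of w] w(1) by linarith
  have 1: "(\<lambda>j. a j * (s ^ j * cos (real j * \<theta>))) sums Re (h w)"
    using sums_Re[OF h[OF w(1)]] by (simp add: w_def rcis_def power_mult_distrib cos_n_Re_cis_pow_n)
  have "(\<lambda>j. Re (of_real (a j) * of_real (Re w) ^ j)) sums Re (h (of_real (Re w)))"
    by (rule sums_Re[OF h[OF w']])
  hence 2: "(\<lambda>j. a j * (s ^ j * cos \<theta> ^ j)) sums Re (h (of_real (Re w)))"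
    by (simp flip: of_real_power of_real_mult add: w power_mult_distrib)
  define T where "T = Re (h (of_real (Re w))) - Re (h w)"
  have "T \<ge> 0" using dom[OF w(1)] by (simp add: T_def)
  have "(\<lambda>j. a j *\<^sub>R (s ^ j * angular_defect j \<theta>)) sums T"
    using sums_diff[OF 2 1] by (simp add: T_def angular_defect_def algebra_simps)
  moreover have "norm (s ^ j * angular_defect j \<theta>) \<le> 2 * R ^ j" for j
  proof -
    have "s ^ j * \<bar>angular_defect j \<theta>\<bar> \<le> R ^ j * 2"
      using s abs_angular_defect_le by (intro mult_mono power_mono) auto
    thus ?thesis using s by (simp add: abs_mult)
  qed
  ultimately have "norm (T - (\<Sum>j\<le>K. a j *\<^sub>R (s ^ j * angular_defect j \<theta>))) \<le> 4 * R ^ (K + 1) * (B / \<rho> ^ K)"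
    using a assms by (intro power_series_tail_le) auto
  moreover have "(\<Sum>j\<le>K. a j *\<^sub>R (s ^ j * angular_defect j \<theta>)) = (\<Sum>j=2..K. a j * R ^ j * r ^ j * angular_defect j \<theta>)"
  proof (rule sum.mono_neutral_cong_right)
    show "\<forall>j\<in>{..K} - {2..K}. a j *\<^sub>R (s ^ j * angular_defect j \<theta>) = 0"
    proof
      fix j assume "j \<in> {..K} - {2..K}"
      hence "j = 0 \<or> j = 1" by auto
      thus "a j *\<^sub>R (s ^ j * angular_defect j \<theta>) = 0" using a by auto
    qed
  qed (auto simp: s_def power_mult_distrib)
  ultimately show "- (4 * R ^ (K + 1) * (B / \<rho> ^ K)) \<le> (\<Sum>j=2..K. a j * R ^ j * r ^ j * angular_defect j \<theta>)"
    using \<open>T \<ge> 0\<close> by auto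
qed

text \<open>
  On a disc of fixed radius \<open>R\<close> the terms of degree greater than \<open>K\<close> disappear as \<open>n \<rightarrow> \<infinity>\<close>, because
  \<open>B n\<close> grows more slowly than \<open>\<rho> n ^ K\<close>. For a degree \<open>j\<close> between 3 and \<open>K\<close>, the bound by the
  quadratic coefficient on that disc reads \<open>\<bar>a n j\<bar> * R ^ j \<le> C * (R\<^sup>2 / 2 + o(1))\<close>. Since \<open>C\<close> is
  independent of \<open>R\<close> and \<open>R\<close> is arbitrary, \<open>a n j\<close> tends to 0, and only \<open>w\<^sup>2 / 2\<close> survives.
\<close>

lemma log_mgf_limit:
  fixes a :: "nat \<Rightarrow> nat \<Rightarrow> real" and h :: "nat \<Rightarrow> complex \<Rightarrow> complex"
  assumes \<rho>: "filterlim \<rho> at_top sequentially"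
    and B: "(\<lambda>n. B n / \<rho> n ^ K) \<longlonglongrightarrow> 0"
    and "K \<ge> 2"
    and ev: "\<forall>\<^sub>F n in sequentially. standardized_log_series (B n) (\<rho> n) (a n) (h n) \<and>
      (\<forall>w. cmod w < \<rho> n \<longrightarrow> Re (h n w) \<le> Re (h n (of_real (Re w))))"
  shows "(\<lambda>n. h n w) \<longlonglongrightarrow> w\<^sup>2 / 2"
proof -
  have \<rho>_ge: "\<forall>\<^sub>F n in sequentially. \<rho> n > x" for x
    using \<rho> by (simp add: filterlim_at_top_dense)
  have higher: "(\<lambda>n. a n j) \<longlonglongrightarrow> 0" if j: "3 \<le> j" "j \<le> K" for j
  proof (rule tendstoI)
    fix e :: real assume "e > 0"
    obtain C where C: "C \<ge> 0" "\<And>a \<tau> j. \<tau> \<ge> 0 \<Longrightarrow> nearly_dominated K \<tau> a \<Longrightarrow> 3 \<le> j \<Longrightarrow> j \<le> K \<Longrightarrow>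
        \<bar>a j\<bar> \<le> C * (\<bar>a 2\<bar> + \<tau>)"
      using coefficients_bounded_by_quadratic_one[of K] by blast
    \<comment> \<open>large enough that \<open>C * (R\<^sup>2 / 2) / R ^ 3\<close> is at most \<open>e / 2\<close>\<close>
    define R where "R = max 1 (C / e)"
    have R: "R \<ge> 1" "C \<le> e * R" using \<open>e > 0\<close> by (auto simp: R_def field_simps max_def)
    define \<tau> where "\<tau> n = 4 * R ^ (K + 1) * (B n / \<rho> n ^ K)" for n
    have "(\<lambda>n. C * \<tau> n) \<longlonglongrightarrow> C * (4 * R ^ (K + 1) * 0)"
      unfolding \<tau>_def by (intro tendsto_intros B)
    hence "\<forall>\<^sub>F n in sequentially. C * \<tau> n < e / 2"
      using \<open>e > 0\<close> by (intro order_tendstoD(2)) auto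
    with ev \<rho>_ge[of "2 * R"] show "\<forall>\<^sub>F n in sequentially. dist (a n j) 0 < e"
    proof eventually_elim
      case (elim n)
      have "\<tau> n \<ge> 0" using elim R by (auto simp: \<tau>_def standardized_log_series_def)
      have dom: "nearly_dominated K (\<tau> n) (\<lambda>j. a n j * R ^ j)"
        unfolding \<tau>_def using elim R
        by (intro dominated_by_real_axis_imp_nearly_dominated[where h = "h n"]) auto
      have a2: "a n 2 = 1 / 2" using elim by (auto simp: standardized_log_series_def)
      from C(2)[OF \<open>\<tau> n \<ge> 0\<close> dom j]
      have "\<bar>a n j\<bar> * R ^ j \<le> C * (R\<^sup>2 / 2 + \<tau> n)" using a2 R by (simp add: abs_mult)
      moreover have "\<bar>a n j\<bar> * R ^ 3 \<le> \<bar>a n j\<bar> * R ^ j"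
        using R j by (intro mult_left_mono power_increasing) auto
      moreover have "C * (R\<^sup>2 / 2) \<le> e * R * (R\<^sup>2 / 2)" using R by (intro mult_right_mono) auto
      moreover have "C * \<tau> n \<le> C * \<tau> n * R ^ 3"
        using R C \<open>\<tau> n \<ge> 0\<close> by (intro mult_right_mono[of 1 "R ^ 3" "C * \<tau> n", simplified mult.commute mult_1_right mult_1_left]) auto
      ultimately have "\<bar>a n j\<bar> * R ^ 3 \<le> (e / 2 + C * \<tau> n) * R ^ 3"
        by (simp add: algebra_simps power2_eq_square power3_eq_cube)
      hence "\<bar>a n j\<bar> \<le> e / 2 + C * \<tau> n" using R by (simp add: mult_le_cancel_right_pos)
      thus ?case using elim by simp
    qed
  qed
  \<comment> \<open>the modulus of the fixed point \<open>w\<close> plays the role of \<open>R\<close>: the series is cut off after degree \<open>K\<close>\<close>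
  define p where "p n = (\<Sum>j\<le>K. a n j *\<^sub>R w ^ j)" for n
  have "(\<lambda>n. h n w - p n) \<longlonglongrightarrow> 0"
  proof (rule Lim_null_comparison)
    show "\<forall>\<^sub>F n in sequentially. norm (h n w - p n) \<le> 4 * cmod w ^ (K + 1) * (B n / \<rho> n ^ K)"
      using ev \<rho>_ge[of "2 * cmod w"] \<rho>_ge[of 0]
    proof eventually_elim
      case (elim n)
      have "cmod w < \<rho> n" using elim norm_ge_zero[of w] by linarith
      thus ?case unfolding p_def using elim
        by (intro power_series_tail_le) (auto simp: norm_power scaleR_conv_of_real standardized_log_series_def)
    qed
    have "(\<lambda>n. 4 * cmod w ^ (K + 1) * (B n / \<rho> n ^ K)) \<longlonglongrightarrow> 4 * cmod w ^ (K + 1) * 0"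
      by (intro tendsto_intros B)
    thus "(\<lambda>n. 4 * cmod w ^ (K + 1) * (B n / \<rho> n ^ K)) \<longlonglongrightarrow> 0" by simp
  qed
  moreover have "p \<longlonglongrightarrow> w\<^sup>2 / 2"
  proof -
    have "(\<lambda>n. a n j) \<longlonglongrightarrow> (if j = 2 then 1 / 2 else 0)" if "j \<le> K" for j
    proof (cases "j \<ge> 3")
      case True thus ?thesis using higher that by auto
    next
      case False
      hence "j = 0 \<or> j = 1 \<or> j = 2" by auto
      hence "\<forall>\<^sub>F n in sequentially. a n j = (if j = 2 then 1 / 2 else 0)"
        using ev by (auto elim!: eventually_mono simp: standardized_log_series_def)
      thus ?thesis by (rule tendsto_eventually)
    qed
    hence "p \<longlonglongrightarrow> (\<Sum>j\<le>K. (if j = 2 then 1 / 2 else 0) *\<^sub>R w ^ j)"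
      unfolding p_def by (intro tendsto_sum tendsto_scaleR tendsto_const) auto
    also have "(\<Sum>j\<le>K. (if j = 2 then 1 / 2 else 0) *\<^sub>R w ^ j) = (\<Sum>j\<le>K. if j = 2 then w\<^sup>2 / 2 else 0)"
      by (intro sum.cong) (auto simp: scaleR_conv_of_real)
    also have "\<dots> = w\<^sup>2 / 2" using \<open>K \<ge> 2\<close> by simp
    finally show ?thesis .
  qed
  ultimately show ?thesis using tendsto_add by fastforce
qed

section \<open>The moment generating function of the standardized variable\<close>

lemma standardized_measurable:
  assumes "X \<in> measurable M (count_space {0..n})"
  shows "standardized M X \<in> borel_measurable M"
proof -
  have "(\<lambda>k. (real k - mean M X) / std_dev M X) \<in> borel_measurable (count_space {0..n})" by simp
  from measurable_compose[OF assms this] show ?thesis unfolding standardized_def[abs_def] .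
qed

lemma expectation_finite_range:
  fixes f :: "nat \<Rightarrow> 'b::{banach, second_countable_topology}"
  assumes "prob_space M" and X: "X \<in> measurable M (count_space {0..n})"
  shows "(LINT \<omega>|M. f (X \<omega>)) = (\<Sum>k=0..n. measure M {\<omega> \<in> space M. X \<omega> = k} *\<^sub>R f k)"
proof -
  interpret prob_space M by fact
  define A where "A k = {\<omega> \<in> space M. X \<omega> = k}" for k
  have A: "A k \<in> sets M" if "k \<in> {0..n}" for k
  proof -
    have "X -` {k} \<inter> space M \<in> sets M" using that by (intro measurable_sets[OF X]) auto
    also have "X -` {k} \<inter> space M = A k" by (auto simp: A_def)
    finally show ?thesis .
  qed
  have "(LINT \<omega>|M. f (X \<omega>)) = (LINT \<omega>|M. (\<Sum>k=0..n. indicator (A k) \<omega> *\<^sub>R f k))"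
  proof (rule Bochner_Integration.integral_cong[OF refl])
    fix \<omega> assume \<omega>: "\<omega> \<in> space M"
    hence "X \<omega> \<in> {0..n}" using measurable_space[OF X] by auto
    have "(\<Sum>k=0..n. indicator (A k) \<omega> *\<^sub>R f k) = (\<Sum>k=0..n. if k = X \<omega> then f k else 0)"
      using \<omega> by (intro sum.cong) (auto simp: A_def indicator_def)
    thus "f (X \<omega>) = (\<Sum>k=0..n. indicator (A k) \<omega> *\<^sub>R f k)"
      using \<open>X \<omega> \<in> {0..n}\<close> by simp
  qed
  also have "\<dots> = (\<Sum>k=0..n. LINT \<omega>|M. indicator (A k) \<omega> *\<^sub>R f k)"
    using A by (intro Bochner_Integration.integral_sum integrable_scaleR_left) (auto intro!: integrable_real_indicator simp: emeasure_eq_measure)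
  also have "\<dots> = (\<Sum>k=0..n. measure M (A k) *\<^sub>R f k)"
    using A by (intro sum.cong refl) (auto simp: emeasure_eq_measure sets.Int_space_eq2 intro!: integrable_real_indicator)
  finally show ?thesis unfolding A_def .
qed

text \<open>
  The moment generating function of the standardized variable is, up to a factor without zeros, the
  generating polynomial at \<open>z = exp (w / \<sigma>)\<close>. For \<open>\<bar>w\<bar> < \<sigma> * \<delta> / 4\<close> this point has distance at most
  \<open>\<delta> / 2\<close> from 1, hence at least \<open>\<delta> / 2\<close> from every root, and so the logarithmic derivative is
  at most \<open>B\<close>, of order \<open>n / (\<sigma> * \<delta>)\<close>. The comparison of \<open>h\<close> at \<open>w\<close> and at \<open>Re w\<close> is
  the logarithm of the triangle inequality for the moment generating function, and rests on the
  probabilities being nonnegative.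
\<close>

lemma standardized_log_mgf:
  assumes "prob_space M" and X: "X \<in> measurable M (count_space {0..n})"
    and \<sigma>: "std_dev M X > 0" and \<delta>: "0 < \<delta>" "\<delta> \<le> 1"
    and roots: "\<And>\<zeta>. poly (pgf M n X) \<zeta> = 0 \<Longrightarrow> \<delta> < cmod (1 - \<zeta>)"
  defines "\<rho> \<equiv> std_dev M X * \<delta> / 8"
  defines "B \<equiv> 5 * real n / (std_dev M X * \<delta>)"
  shows "\<exists>a h. standardized_log_series B \<rho> a h \<and> (\<forall>w. cmod w < \<rho> \<longrightarrow>
    Re (h w) \<le> Re (h (of_real (Re w))) \<and>
    exp (h w) = (CLINT \<omega>|M. exp (w * of_real (standardized M X \<omega>))))"
proof -
  define \<sigma> where "\<sigma> = std_dev M X"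
  define \<mu> where "\<mu> = mean M X"
  define p where "p k = measure M {\<omega> \<in> space M. X \<omega> = k}" for k
  define x where "x k = (real k - \<mu>) / \<sigma>" for k
  define P where "P = pgf M n X"
  note E = expectation_finite_range[OF assms(1) X, folded p_def]
  have "\<sigma> > 0" using \<sigma> by (simp add: \<sigma>_def)
  have p_nonneg: "p k \<ge> 0" for k by (simp add: p_def)
  have p_sum: "(\<Sum>k=0..n. p k) = 1" using E[of "\<lambda>_. 1::real"] assms(1) by (simp add: prob_space.prob_space)
  have p_mean: "(\<Sum>k=0..n. p k * real k) = \<mu>" using E[of real] by (simp add: \<mu>_def mean_def)
  have \<mu>_bounds: "0 \<le> \<mu>" "\<mu> \<le> real n"
  proof -
    show "0 \<le> \<mu>" unfolding p_mean[symmetric] using p_nonneg by (intro sum_nonneg) auto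
    have "(\<Sum>k=0..n. p k * real k) \<le> (\<Sum>k=0..n. p k * real n)"
      using p_nonneg by (intro sum_mono mult_left_mono) auto
    also have "\<dots> = real n" using p_sum by (simp flip: sum_distrib_right)
    finally show "\<mu> \<le> real n" using p_mean by simp
  qed
  have p_var: "(\<Sum>k=0..n. p k * (real k - \<mu>)\<^sup>2) = \<sigma>\<^sup>2"
  proof -
    have "\<sigma> = sqrt (LINT \<omega>|M. (real (X \<omega>) - \<mu>)\<^sup>2)" by (simp add: \<sigma>_def std_dev_def \<mu>_def mean_def)
    hence "\<sigma> = sqrt (\<Sum>k=0..n. p k * (real k - \<mu>)\<^sup>2)" using E[of "\<lambda>k. (real k - \<mu>)\<^sup>2"] by simp
    thus ?thesis using p_nonneg by (simp add: sum_nonneg)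
  qed
  have x_mean: "(\<Sum>k=0..n. p k * x k) = 0"
  proof -
    have "(\<Sum>k=0..n. p k * x k) = ((\<Sum>k=0..n. p k * real k) - (\<Sum>k=0..n. p k) * \<mu>) / \<sigma>"
      by (simp add: x_def sum_subtractf sum_distrib_right right_diff_distrib diff_divide_distrib sum_divide_distrib)
    thus ?thesis by (simp add: p_mean p_sum)
  qed
  have x_var: "(\<Sum>k=0..n. p k * (x k)\<^sup>2) = 1"
  proof -
    have "(\<Sum>k=0..n. p k * (x k)\<^sup>2) = (\<Sum>k=0..n. p k * (real k - \<mu>)\<^sup>2) / \<sigma>\<^sup>2"
      by (simp add: x_def power_divide sum_divide_distrib)
    thus ?thesis using \<open>\<sigma> > 0\<close> by (simp add: p_var)
  qed
  define g where "g w = (\<Sum>k=0..n. of_real (p k) * exp (w * of_real (x k)))" for w :: complex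
  define g' where "g' w = (\<Sum>k=0..n. of_real (p k * x k) * exp (w * of_real (x k)))" for w :: complex
  have g: "(g has_field_derivative g' w) (at w)" for w
    unfolding g_def g'_def by (auto intro!: derivative_eq_intros sum.cong)
  have g'_deriv: "(g' has_field_derivative (\<Sum>k=0..n. of_real (p k * (x k)\<^sup>2) * exp (w * of_real (x k)))) (at w)" for w
    unfolding g'_def by (auto intro!: derivative_eq_intros sum.cong simp: power2_eq_square)
  have g'': "(g' has_field_derivative 1) (at 0)"
    using g'_deriv[of 0] by (simp only: mult_zero_left exp_zero mult_1_right flip: of_real_sum) (simp add: x_var)
  have g_0: "g 0 = 1" "g' 0 = 0"
    unfolding g_def g'_def by (simp_all only: mult_zero_left exp_zero mult_1_right p_sum x_mean of_real_1 of_real_0 flip: of_real_sum)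
  have g_cnj: "g (cnj w) = cnj (g w)" "g' (cnj w) = cnj (g' w)" for w
    by (simp_all add: g_def g'_def exp_cnj)
  have poly_P: "poly P z = (\<Sum>k=0..n. of_real (p k) * z ^ k)" for z
    by (simp add: P_def pgf_def p_def poly_sum poly_monom)
  have deg_P: "degree P \<le> n"
    unfolding P_def pgf_def by (intro degree_sum_le) (auto intro: order_trans[OF degree_monom_le])
  have g_P: "g w = exp (- (w * of_real (\<mu> / \<sigma>))) * poly P (exp (w / of_real \<sigma>))" for w
  proof -
    have "exp (w * of_real (x k)) = exp (- (w * of_real (\<mu> / \<sigma>))) * exp (w / of_real \<sigma>) ^ k" for k
      using \<open>\<sigma> > 0\<close> by (simp add: x_def exp_add[symmetric] exp_of_nat_mult[symmetric] diff_divide_distrib algebra_simps)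
    thus ?thesis unfolding g_def poly_P by (simp add: sum_distrib_left algebra_simps)
  qed
  \<comment> \<open>differentiating the factorisation; the result equals \<open>g'\<close> by uniqueness of derivatives\<close>
  have g'_P: "g' w = exp (- (w * of_real (\<mu> / \<sigma>))) *
      (exp (w / of_real \<sigma>) * poly (pderiv P) (exp (w / of_real \<sigma>)) - of_real \<mu> * poly P (exp (w / of_real \<sigma>))) / of_real \<sigma>" for w
  proof (rule DERIV_unique[OF g])
    have d: "((\<lambda>w. poly P (exp (w / of_real \<sigma>))) has_field_derivative
       poly (pderiv P) (exp (w / of_real \<sigma>)) * (exp (w / of_real \<sigma>) / of_real \<sigma>)) (at w)"
      by (rule DERIV_chain2[OF poly_DERIV]) (use \<open>\<sigma> > 0\<close> in \<open>auto intro!: derivative_eq_intros\<close>)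
    show "(g has_field_derivative exp (- (w * of_real (\<mu> / \<sigma>))) *
      (exp (w / of_real \<sigma>) * poly (pderiv P) (exp (w / of_real \<sigma>)) - of_real \<mu> * poly P (exp (w / of_real \<sigma>))) / of_real \<sigma>) (at w)"
      unfolding g_P[abs_def] using \<open>\<sigma> > 0\<close> 
      by (auto intro!: derivative_eq_intros d simp: field_simps)
  qed
  have \<rho>: "\<rho> > 0" "2 * \<rho> = \<sigma> * \<delta> / 4" using \<open>\<sigma> > 0\<close> \<delta> by (auto simp: \<rho>_def \<sigma>_def)
  have near_1: "cmod (exp (w / of_real \<sigma>) - 1) \<le> \<delta> / 2" if "cmod w < 2 * \<rho>" for w
  proof -
    have "cmod (w / of_real \<sigma>) < \<delta> / 4"
      using that \<rho> \<open>\<sigma> > 0\<close> by (simp add: norm_divide field_simps)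
    thus ?thesis using norm_exp_bounds(2)[of "w / of_real \<sigma>"] \<delta> by linarith
  qed
  have nz: "g w \<noteq> 0" if "cmod w < 2 * \<rho>" for w
    using near_1[OF that] roots[of "exp (w / of_real \<sigma>)"] \<delta> 
    unfolding g_P P_def[symmetric] by (auto simp: norm_minus_commute)
  have bound: "cmod (g' w) \<le> B * cmod (g w)" if "cmod w < 2 * \<rho>" for w
  proof -
    define z where "z = exp (w / of_real \<sigma>)"
    define e where "e = exp (- (w * of_real (\<mu> / \<sigma>)))"
    have z: "cmod (z - 1) \<le> \<delta> / 2" using near_1[OF that] by (simp add: z_def)
    have "cmod z \<le> 2" using norm_triangle_ineq[of "z - 1" 1] z \<delta> by simp
    \<comment> \<open>the perturbation \<open>z\<close> of 1 uses up at most half of the distance from 1 to the root\<close>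
    have far: "1 \<le> 2 / \<delta> * cmod (z - \<zeta>)" if "poly P \<zeta> = 0" for \<zeta>
    proof -
      have "\<delta> < cmod (1 - \<zeta>)" using roots that by (simp add: P_def)
      also have "\<dots> \<le> cmod (z - \<zeta>) + cmod (z - 1)"
        using norm_triangle_ineq4[of "z - \<zeta>" "z - 1"] by simp
      finally show ?thesis using z \<delta> by (simp add: field_simps)
    qed
    have "cmod (poly (pderiv P) z) \<le> real (degree P) * (2 / \<delta>) * cmod (poly P z)"
      by (rule logarithmic_derivative_bound[OF far])
    also have "\<dots> \<le> real n * (2 / \<delta>) * cmod (poly P z)"
      using deg_P \<delta> by (intro mult_right_mono) auto
    finally have P': "cmod (poly (pderiv P) z) \<le> real n * (2 / \<delta>) * cmod (poly P z)" .
    have "cmod (z * poly (pderiv P) z - of_real \<mu> * poly P z)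
        \<le> cmod z * cmod (poly (pderiv P) z) + \<mu> * cmod (poly P z)"
      using norm_triangle_ineq4[of "z * poly (pderiv P) z" "of_real \<mu> * poly P z"] \<mu>_bounds
      by (simp add: norm_mult)
    also have "\<dots> \<le> 2 * (real n * (2 / \<delta>) * cmod (poly P z)) + real n * (1 / \<delta>) * cmod (poly P z)"
    proof (intro add_mono mult_mono P' \<open>cmod z \<le> 2\<close>)
      have "real n * 1 \<le> real n * (1 / \<delta>)" using \<delta> by (intro mult_left_mono) auto
      thus "\<mu> \<le> real n * (1 / \<delta>)" using \<mu>_bounds by linarith
    qed (use \<delta> in auto)
    also have "\<dots> = 5 * real n / \<delta> * cmod (poly P z)" by (simp add: field_simps)
    finally have "cmod (z * poly (pderiv P) z - of_real \<mu> * poly P z) \<le> 5 * real n / \<delta> * cmod (poly P z)" .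
    hence "cmod e * cmod (z * poly (pderiv P) z - of_real \<mu> * poly P z) / \<sigma>
        \<le> cmod e * (5 * real n / \<delta> * cmod (poly P z)) / \<sigma>"
      using \<open>\<sigma> > 0\<close> by (intro divide_right_mono mult_left_mono) auto
    moreover have "cmod (g' w) = cmod e * cmod (z * poly (pderiv P) z - of_real \<mu> * poly P z) / \<sigma>"
      using \<open>\<sigma> > 0\<close> unfolding g'_P z_def e_def by (simp only: norm_mult norm_divide norm_of_real abs_of_pos)
    moreover have "B * cmod (g w) = cmod e * (5 * real n / \<delta> * cmod (poly P z)) / \<sigma>"
      unfolding g_P z_def e_def B_def \<sigma>_def by (simp add: norm_mult field_simps)
    ultimately show ?thesis by simp
  qed
  have "\<exists>a h. standardized_log_series B \<rho> a h \<and> (\<forall>w. cmod w < \<rho> \<longrightarrow> exp (h w) = g w)"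
    by (rule log_power_series[of g g']) (fact g g'' g_0 g_cnj \<rho>(1) nz bound)+
  then obtain a h where ah: "standardized_log_series B \<rho> a h"
      "\<And>w. cmod w < \<rho> \<Longrightarrow> exp (h w) = g w"
    by blast
  have dom: "Re (h w) \<le> Re (h (of_real (Re w)))" if "cmod w < \<rho>" for w
  proof -
    have w': "cmod (of_real (Re w)) < \<rho>"
      unfolding norm_of_real using that abs_Re_le_cmod[of w] by linarith
    have "exp (Re (h w)) = cmod (g w)" using ah(2)[OF that] by (metis norm_exp_eq_Re)
    also have "\<dots> \<le> (\<Sum>k=0..n. p k * exp (Re w * x k))"
      unfolding g_def by (rule sum_norm_le) (simp add: norm_mult p_nonneg)
    also have "\<dots> = Re (g (of_real (Re w)))" by (simp add: g_def exp_of_real flip: of_real_mult)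
    also have "\<dots> \<le> cmod (g (of_real (Re w)))" by (rule complex_Re_le_cmod)
    also have "\<dots> = exp (Re (h (of_real (Re w))))" using ah(2)[OF w'] by (metis norm_exp_eq_Re)
    finally show ?thesis by simp
  qed
  have mgf: "g w = (CLINT \<omega>|M. exp (w * of_real (standardized M X \<omega>)))" for w
    using E[of "\<lambda>k. exp (w * of_real (x k))"]
    by (simp add: g_def standardized_def x_def \<mu>_def \<sigma>_def scaleR_conv_of_real)
  show ?thesis using ah dom unfolding mgf by blast
qed

section \<open>The central limit theorem\<close>

theorem theorem1:
  fixes \<epsilon> :: real and M :: "nat \<Rightarrow> 'a measure" and X :: "nat \<Rightarrow> 'a \<Rightarrow> nat"
  assumes "\<epsilon> > 0"
    and "\<And>n. prob_space (M n)"
    and "\<And>n. X n \<in> measurable (M n) (count_space {0..n})"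
    and "\<forall>\<^sub>F n in sequentially.
           std_dev (M n) (X n) > real n powr \<epsilon> \<and>
           (\<forall>\<zeta>::complex. poly (pgf (M n) n (X n)) \<zeta> = 0 \<longrightarrow>
              cmod (1 - \<zeta>) > 1 / std_dev (M n) (X n) powr (1 - \<epsilon>))"
  shows "satisfies_clt M X"
proof -
  define \<sigma> where "\<sigma> n = std_dev (M n) (X n)" for n
  \<comment> \<open>decreasing the exponent to at most 1 weakens the hypotheses and keeps \<open>\<delta> n \<le> 1\<close>\<close>
  define \<eta> where "\<eta> = min \<epsilon> 1"
  have \<eta>: "0 < \<eta>" "\<eta> \<le> \<epsilon>" "\<eta> \<le> 1" using assms(1) by (auto simp: \<eta>_def)
  define \<delta> where "\<delta> n = \<sigma> n powr (\<eta> - 1)" for n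
  define good where "good n \<longleftrightarrow> n \<ge> 1 \<and> \<sigma> n \<ge> 1 \<and> real n powr \<eta> \<le> \<sigma> n \<and> 0 < \<delta> n \<and> \<delta> n \<le> 1 \<and>
      (\<forall>\<zeta>. poly (pgf (M n) n (X n)) \<zeta> = 0 \<longrightarrow> \<delta> n < cmod (1 - \<zeta>))" for n
  have good: "\<forall>\<^sub>F n in sequentially. good n"
    using assms(4) eventually_ge_at_top[of 1]
  proof eventually_elim
    case (elim n)
    have "1 \<le> real n powr \<epsilon>" using elim \<eta> by (intro ge_one_powr_ge_zero) auto
    hence \<sigma>1: "\<sigma> n \<ge> 1" using elim by (simp add: \<sigma>_def)
    have "real n powr \<eta> \<le> real n powr \<epsilon>" using elim \<eta> by (intro powr_mono) auto
    hence "real n powr \<eta> \<le> \<sigma> n" using elim by (simp add: \<sigma>_def)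
    moreover have "\<delta> n > 0" using \<sigma>1 by (simp add: \<delta>_def)
    moreover have "\<delta> n \<le> \<sigma> n powr 0" unfolding \<delta>_def using \<sigma>1 \<eta> by (intro powr_mono) auto
    hence "\<delta> n \<le> 1" using \<sigma>1 by simp
    moreover have "\<delta> n \<le> 1 / \<sigma> n powr (1 - \<epsilon>)"
    proof -
      have "\<delta> n \<le> \<sigma> n powr (- (1 - \<epsilon>))" unfolding \<delta>_def using \<sigma>1 \<eta> by (intro powr_mono) auto
      thus ?thesis by (simp only: powr_minus_divide)
    qed
    ultimately show ?case using elim \<sigma>1 unfolding good_def \<sigma>_def[symmetric] by (auto intro: le_less_trans)
  qed
  define \<rho> where "\<rho> n = \<sigma> n * \<delta> n / 8" for n
  define B where "B n = 5 * real n / (\<sigma> n * \<delta> n)" for n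
  have "\<exists>a h. good n \<longrightarrow> standardized_log_series (B n) (\<rho> n) a h \<and> (\<forall>w. cmod w < \<rho> n \<longrightarrow>
      Re (h w) \<le> Re (h (of_real (Re w))) \<and>
      exp (h w) = (CLINT \<omega>|M n. exp (w * of_real (standardized (M n) (X n) \<omega>))))" for n
  proof (cases "good n")
    case True
    have "std_dev (M n) (X n) > 0" "0 < \<delta> n" "\<delta> n \<le> 1"
       "\<And>\<zeta>. poly (pgf (M n) n (X n)) \<zeta> = 0 \<Longrightarrow> \<delta> n < cmod (1 - \<zeta>)"
      using True by (auto simp: good_def \<sigma>_def)
    from standardized_log_mgf[OF assms(2,3) this]
    show ?thesis unfolding B_def \<rho>_def \<sigma>_def by blast
  qed auto
  then obtain a h where
    ah: "\<And>n. good n \<Longrightarrow> standardized_log_series (B n) (\<rho> n) (a n) (h n) \<and> (\<forall>w. cmod w < \<rho> n \<longrightarrow>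
      Re (h n w) \<le> Re (h n (of_real (Re w))) \<and>
      exp (h n w) = (CLINT \<omega>|M n. exp (w * of_real (standardized (M n) (X n) \<omega>))))"
    by metis
  \<comment> \<open>\<open>\<sigma> n * \<delta> n = \<sigma> n powr \<eta>\<close> and \<open>\<sigma> n \<ge> n powr \<eta>\<close>, so the radius grows at least like \<open>n powr \<kappa>\<close>\<close>
  define \<kappa> where "\<kappa> = \<eta> * \<eta>"
  have "\<kappa> > 0" using \<eta> by (simp add: \<kappa>_def)
  have \<rho>_lower: "real n powr \<kappa> / 8 \<le> \<rho> n" if "good n" for n
  proof -
    have "real n powr \<kappa> = (real n powr \<eta>) powr \<eta>" by (simp add: powr_powr \<kappa>_def)
    also have "\<dots> \<le> \<sigma> n powr \<eta>" using that \<eta> by (intro powr_mono2) (auto simp: good_def)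
    also have "\<dots> = \<sigma> n * \<delta> n"
      using that powr_add[of "\<sigma> n" 1 "\<eta> - 1"] by (simp add: \<delta>_def good_def)
    finally show ?thesis by (simp add: \<rho>_def)
  qed
  have \<rho>_lim: "filterlim \<rho> at_top sequentially"
  proof (rule filterlim_at_top_mono)
    show "filterlim (\<lambda>n. real n powr \<kappa> / 8) at_top sequentially"
      using \<open>\<kappa> > 0\<close> by real_asymp
    show "\<forall>\<^sub>F n in sequentially. real n powr \<kappa> / 8 \<le> \<rho> n"
      using good \<rho>_lower by (auto elim: eventually_mono)
  qed
  \<comment> \<open>\<open>B n\<close> is at most linear in \<open>n\<close>, and this \<open>K\<close> makes \<open>\<rho> n ^ K\<close> grow at least quadratically\<close>
  define K where "K = max 2 (nat \<lceil>2 / \<kappa>\<rceil>)"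
  have "2 / \<kappa> \<le> real K" unfolding K_def by linarith
  hence K: "K \<ge> 2" "2 \<le> \<kappa> * real K" using \<open>\<kappa> > 0\<close> by (auto simp: K_def field_simps)
  have B_lim: "(\<lambda>n. B n / \<rho> n ^ K) \<longlonglongrightarrow> 0"
  proof (rule Lim_null_comparison)
    show "\<forall>\<^sub>F n in sequentially. norm (B n / \<rho> n ^ K) \<le> (5 * 8 ^ K) / real n"
      using good
    proof eventually_elim
      case (elim n)
      have n: "real n \<ge> 1" using elim by (simp add: good_def)
      have "1 \<le> real n powr \<kappa>" using n \<open>\<kappa> > 0\<close> by (intro ge_one_powr_ge_zero) auto
      hence "1 \<le> \<sigma> n * \<delta> n" using \<rho>_lower[OF elim] by (simp add: \<rho>_def)
      hence B: "0 \<le> B n" "B n \<le> 5 * real n" by (auto simp: B_def field_simps mult_le_cancel_left1)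
      have "real n ^ 2 = real n powr 2" using n by (simp add: powr_numeral)
      also have "\<dots> \<le> real n powr (\<kappa> * real K)" using n K by (intro powr_mono) auto
      also have "\<dots> = (real n powr \<kappa>) ^ K" using n by (simp add: powr_powr[symmetric] powr_realpow)
      finally have "real n ^ 2 / 8 ^ K \<le> (real n powr \<kappa> / 8) ^ K" by (simp add: power_divide divide_right_mono)
      also have "\<dots> \<le> \<rho> n ^ K" using \<rho>_lower[OF elim] by (intro power_mono) auto
      finally have *: "real n ^ 2 / 8 ^ K \<le> \<rho> n ^ K" .
      have "B n / \<rho> n ^ K \<le> 5 * real n / (real n ^ 2 / 8 ^ K)"
        using * B n by (intro frac_le) auto
      also have "\<dots> = (5 * 8 ^ K) / real n" using n by (simp add: field_simps power2_eq_square)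
      finally have "B n / \<rho> n ^ K \<le> (5 * 8 ^ K) / real n" .
      moreover have "0 \<le> B n / \<rho> n ^ K"
        using * B n by (intro divide_nonneg_nonneg order_trans[OF _ *]) auto
      ultimately show ?case by simp
    qed
    show "(\<lambda>n. (5 * 8 ^ K) / real n) \<longlonglongrightarrow> 0" by real_asymp
  qed
  have ev: "\<forall>\<^sub>F n in sequentially. standardized_log_series (B n) (\<rho> n) (a n) (h n) \<and>
      (\<forall>w. cmod w < \<rho> n \<longrightarrow> Re (h n w) \<le> Re (h n (of_real (Re w))))"
    using good by eventually_elim (use ah in blast)
  have h_lim: "(\<lambda>n. h n w) \<longlonglongrightarrow> w\<^sup>2 / 2" for w
    by (rule log_mgf_limit[OF \<rho>_lim B_lim K(1) ev])
  define D where "D n = distr (M n) borel (standardized (M n) (X n))" for n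
  note [measurable] = standardized_measurable[OF assms(3)]
  have "weak_conv_m D std_normal_distribution"
  proof (rule levy_continuity)
    show "real_distribution (D n)" for n
      unfolding D_def by (intro prob_space.real_distribution_distr assms(2)) measurable
    show "real_distribution std_normal_distribution" by (rule real_dist_normal_dist)
    show "(\<lambda>n. char (D n) t) \<longlonglongrightarrow> char std_normal_distribution t" for t
    proof -
      have "\<forall>\<^sub>F n in sequentially. exp (h n (\<i> * of_real t)) = char (D n) t"
        using good filterlim_at_top_dense[THEN iffD1, OF \<rho>_lim, rule_format, of "\<bar>t\<bar>"]
      proof eventually_elim
        case (elim n)
        have "char (D n) t = (CLINT \<omega>|M n. exp (\<i> * of_real t * of_real (standardized (M n) (X n) \<omega>)))"
          unfolding char_def D_def by (subst integral_distr) (simp_all add: mult.assoc)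
        thus ?case using ah[OF elim(1)] elim(2) by (simp add: norm_mult)
      qed
      moreover have "(\<lambda>n. exp (h n (\<i> * of_real t))) \<longlonglongrightarrow> exp ((\<i> * of_real t)\<^sup>2 / 2)"
        by (intro tendsto_exp h_lim)
      moreover have "exp ((\<i> * of_real t)\<^sup>2 / 2) = char std_normal_distribution t"
        by (simp add: char_std_normal_distribution power_mult_distrib flip: exp_of_real)
      ultimately show ?thesis by (simp add: Lim_transform_eventually)
    qed
  qed
  moreover have "\<forall>\<^sub>F n in sequentially. std_dev (M n) (X n) > 0"
    using good by eventually_elim (simp add: good_def \<sigma>_def)
  ultimately show ?thesis unfolding satisfies_clt_def D_def by simp
qed

end
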